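(* Let $0<\alpha<1$, $\beta>1$, $L>0$, $k>0$, and let $G$ be an undirected and connected graph with $N$ nodes and adjacency matrix $A=(a_{ij})$. Consider the multi-agent system, for $x\in[0,L]$, $t\ge 0$, $i=1,\dots,N$, $$y_{i,t}(x,t)=k\,y_{i,xx}(x,t)+u_i(x,t),\qquad y_i(0,t)=y_i(L,t)=0,\qquad y_i(x,0)=y_i^0(x),$$ where each $y_i^0$ is bounded and continuous on $[0,L]$, with controller $$u_i(x,t)=-\sum_{j=1}^{N}a_{ij}\left(\int_0^L\xi_{ij}(x,t)^{2}\,\mathrm{d}x\right)^{\alpha-1}\xi_{ij}(x,t)-\sum_{j=1}^{N}a_{ij}\left(\int_0^L\xi_{ij}(x,t)^{2}\,\mathrm{d}x\right)^{\beta-1}\xi_{ij}(x,t),$$ where $\xi_{ij}(x,t)=y_i(x,t)-y_j(x,t)$. Then the system achieves fixed-time consensus, and the finite terminal time $t^*$ satisfies $$t^*\le T_{\max}:=\frac{1}{C_1(1-\alpha)}+\frac{1}{(N^{1-\beta})^2C_2(\beta-1)},$$ where $C_1=\left(2\lambda_2(\mathcal{L}(B))\right)^{\alpha}$ and $C_2=\left(2\lambda_2(\mathcal{L}(P))\right)^{\beta}$ with $B=(a_{ij}^{1/\alpha})\in\mathbb R^{N\times N}$ and $P=(a_{ij}^{1/\beta})\in\mathbb R^{N\times N}$.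
   Context: Graph: $G=\{\mathfrak V,\mathfrak E,A\}$ has vertices $v_1,\dots,v_N$ and nonnegative adjacency matrix $A=(a_{ij})$, with $a_{ij}>0$ if node $v_i$ can receive data from $v_j$ (i.e. $(v_j,v_i)\in\mathfrak E$, $v_j\in N_i$), and $a_{ij}=0$ otherwise. Undirected means $a_{ij}=a_{ji}$. An undirected graph is connected if for any pair $v_i,v_j$ there is a sequence $a_{ii_1},a_{i_1i_2},\dots,a_{i_mj}$ all of whose elements are positive. Laplacian: for a nonnegative matrix $M=(m_{ij})$ viewed as an adjacency matrix, $\mathcal L(M)=(l_{ij})$ with $l_{ij}=-m_{ij}$ for $j\neq i$ and $l_{ii}=\sum_{j\ne i}m_{ij}$. For symmetric $\mathcal L(M)$, $\lambda_2(\mathcal L(M))=\min_{x\ne0,\ \langle x,\mathbf 1\rangle=0}\frac{\langle x,\mathcal L(M)x\rangle}{\langle x,x\rangle}$, the second smallest eigenvalue, where $\mathbf 1=[1,\dots,1]^T$. Finite-time consensus (FTC): there exists a finite time $t^*$ (the terminal time) such that $\lim_{t\to t^*}|y_i(x,t)-y_j(x,t)|=0$ for any $x\in[0,L]$ and $i,j=1,\dots,N$. Fixed-time consensus (FXC): FTC holds and in addition the terminal time $t^*$ is bounded by a positive constant $T_{\max}$ independent of the initial condition. Subscripts $t$, $xx$ denote partial derivatives. The term $\left(\int_0^L\xi_{ij}^2\,\mathrm dx\right)^{\alpha-1}\xi_{ij}$ is read as $0$ when $\xi_{ij}(\cdot,t)\equiv0$ (in particular for $i=j$). *)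

theory Defs
  imports "HOL-Analysis.Analysis"
begin

text \<open>
  The vertices are the elements of a finite type, so that \<open>N\<close> is \<open>CARD('n)\<close>, and a graph is given
  by its adjacency matrix: there is an edge from \<open>j\<close> to \<open>i\<close> iff \<open>A $ i $ j > 0\<close>.
\<close>

definition adjacency_matrix :: "real^'n^'n \<Rightarrow> bool" where
  "adjacency_matrix A \<longleftrightarrow> (\<forall>i j. 0 \<le> A $ i $ j)"

definition undirected_graph :: "real^'n^'n \<Rightarrow> bool" where
  "undirected_graph A \<longleftrightarrow> (\<forall>i j. A $ i $ j = A $ j $ i)"

definition connected_graph :: "real^'n^'n \<Rightarrow> bool" where
  "connected_graph A \<longleftrightarrow> (\<forall>i j. i \<noteq> j \<longrightarrow> (\<lambda>p q. 0 < A $ p $ q)\<^sup>+\<^sup>+ i j)"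

definition laplacian :: "real^'n^'n \<Rightarrow> real^'n^'n" where
  "laplacian M = (\<chi> i j. if i = j then (\<Sum>l\<in>UNIV - {i}. M $ i $ l) else - M $ i $ j)"

text \<open>The minimum is attained whenever \<open>CARD('n) \<ge> 2\<close>; for a single vertex the value is unspecified.\<close>

definition lambda2 :: "real^'n^'n \<Rightarrow> real" where
  "lambda2 Q = (LEAST r. \<exists>x. x \<noteq> 0 \<and> x \<bullet> vec 1 = 0 \<and> r = (x \<bullet> (Q *v x)) / (x \<bullet> x))"

definition entrywise_powr :: "real^'n^'n \<Rightarrow> real \<Rightarrow> real^'n^'n" where
  "entrywise_powr M r = (\<chi> i j. M $ i $ j powr r)"

text \<open>
  A trajectory is a function \<open>y\<close> with \<open>y i x t\<close> the state of agent \<open>i\<close> at position \<open>x\<close> and time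
  \<open>t\<close>. As \<open>0 powr r = 0\<close> for every \<open>r\<close>, the summands of the controller vanish when \<open>y i\<close> and
  \<open>y j\<close> agree at time \<open>t\<close>, also for a negative exponent.
\<close>

definition feedback :: "real \<Rightarrow> real \<Rightarrow> real^'n^'n \<Rightarrow> ('n \<Rightarrow> real \<Rightarrow> real \<Rightarrow> real)
    \<Rightarrow> 'n \<Rightarrow> real \<Rightarrow> real \<Rightarrow> real" where
  "feedback L p A y i x t =
     (\<Sum>j\<in>UNIV. A $ i $ j * (integral {0..L} (\<lambda>z. (y i z t - y j z t)\<^sup>2)) powr (p - 1)
                  * (y i x t - y j x t))"

definition controller :: "real \<Rightarrow> real \<Rightarrow> real \<Rightarrow> real^'n^'n \<Rightarrow> ('n \<Rightarrow> real \<Rightarrow> real \<Rightarrow> real)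
    \<Rightarrow> 'n \<Rightarrow> real \<Rightarrow> real \<Rightarrow> real" where
  "controller L \<alpha> \<beta> A y i x t = - feedback L \<alpha> A y i x t - feedback L \<beta> A y i x t"

text \<open>
  Solutions are classical, up to the following points.
  \<^item> The initial data are merely continuous, so the differential equation is required for \<open>t > 0\<close>.
  \<^item> The initial data need not vanish at \<open>0\<close> and \<open>L\<close>, so the boundary condition is required
    for \<open>t > 0\<close>, and continuity of \<open>y i\<close> is not required at the corners \<open>(0, 0)\<close> and \<open>(L, 0)\<close>.
  \<^item> The differential equation may fail at a closed countable set \<open>S\<close> of instants, across which
    \<open>y i\<close> stays continuous. For \<open>\<alpha> \<le> 1/2\<close> the controller is not continuous where two agents
    meet: already for two agents the squared distance then vanishes like
    \<open>(t\<^sup>* - t) powr (1 / (1 - \<alpha>))\<close>, so \<open>y i\<close> has no time derivative at \<open>t\<^sup>*\<close>.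
    The choice \<open>S = {}\<close> gives solutions in the strict sense.
  Spatial derivatives at \<open>0\<close> and \<open>L\<close> are one-sided.
\<close>

definition solves :: "real \<Rightarrow> real \<Rightarrow> real \<Rightarrow> real \<Rightarrow> real^'n^'n \<Rightarrow> ('n \<Rightarrow> real \<Rightarrow> real)
    \<Rightarrow> ('n \<Rightarrow> real \<Rightarrow> real \<Rightarrow> real) \<Rightarrow> bool" where
  "solves L k \<alpha> \<beta> A y0 y \<longleftrightarrow>
     (\<forall>i. continuous_on ({0..L} \<times> {0..} - {(0, 0), (L, 0)}) (\<lambda>(x, t). y i x t)) \<and>
     (\<forall>i. \<forall>x\<in>{0..L}. y i x 0 = y0 i x) \<and>
     (\<forall>i. \<forall>t>0. y i 0 t = 0 \<and> y i L t = 0) \<and>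
     (\<exists>S yt yx yxx. closed S \<and> countable S \<and>
        (\<forall>i. continuous_on ({0..L} \<times> ({0<..} - S)) (\<lambda>(x, t). yt i x t)) \<and>
        (\<forall>i. continuous_on ({0..L} \<times> ({0<..} - S)) (\<lambda>(x, t). yxx i x t)) \<and>
        (\<forall>i. \<forall>x\<in>{0..L}. \<forall>t\<in>{0<..} - S.
           ((\<lambda>s. y i x s) has_real_derivative yt i x t) (at t) \<and>
           ((\<lambda>z. y i z t) has_real_derivative yx i x t) (at x within {0..L}) \<and>
           ((\<lambda>z. yx i z t) has_real_derivative yxx i x t) (at x within {0..L}) \<and>
           yt i x t = k * yxx i x t + controller L \<alpha> \<beta> A y i x t))"

definition trajectories :: "real \<Rightarrow> real \<Rightarrow> real \<Rightarrow> real \<Rightarrow> real^'n^'n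
    \<Rightarrow> ('n \<Rightarrow> real \<Rightarrow> real \<Rightarrow> real) set" where
  "trajectories L k \<alpha> \<beta> A =
     {y. \<exists>y0. (\<forall>i. bounded (y0 i ` {0..L}) \<and> continuous_on {0..L} (y0 i)) \<and>
              solves L k \<alpha> \<beta> A y0 y}"

definition terminal_time :: "real \<Rightarrow> ('n \<Rightarrow> real \<Rightarrow> real \<Rightarrow> real) \<Rightarrow> real \<Rightarrow> bool" where
  "terminal_time L y ts \<longleftrightarrow>
     0 \<le> ts \<and>
     (\<forall>x\<in>{0..L}. \<forall>i j. ((\<lambda>t. \<bar>y i x t - y j x t\<bar>) \<longlongrightarrow> 0) (at ts within {0..}))"

text \<open>
  Consensus is a property of a system, which is represented by the set \<open>Y\<close> of its trajectories
  from all initial conditions.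
\<close>

definition finite_time_consensus :: "real \<Rightarrow> ('n \<Rightarrow> real \<Rightarrow> real \<Rightarrow> real) set \<Rightarrow> bool" where
  "finite_time_consensus L Y \<longleftrightarrow> (\<forall>y\<in>Y. \<exists>ts. terminal_time L y ts)"

definition fixed_time_consensus :: "real \<Rightarrow> ('n \<Rightarrow> real \<Rightarrow> real \<Rightarrow> real) set \<Rightarrow> bool" where
  "fixed_time_consensus L Y \<longleftrightarrow>
     finite_time_consensus L Y \<and> (\<exists>Tmax>0. \<forall>y\<in>Y. \<exists>ts\<le>Tmax. terminal_time L y ts)"

end

theory Submission
  imports Defs
begin

text \<open>
  The squared deviations of the agents from their mean, summed over the agents and integrated over
  \<open>{0..L}\<close>, form a Lyapunov function \<open>V\<close>. The Dirichlet condition makes the diffusion term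
  nonpositive, and pairing the controller with the deviations gives
  \<open>V' \<le> - (\<Sum>i j. a i j * W i j powr \<alpha>) - (\<Sum>i j. a i j * W i j powr \<beta>)\<close>, with
  \<open>W i j\<close> the integral of the squared distance of two agents. Subadditivity of \<open>powr \<alpha>\<close>, Jensen's
  inequality for \<open>powr \<beta>\<close> over the \<open>N\<^sup>2\<close> pairs and the variational description of
  \<open>\<lambda>\<^sub>2\<close> turn this into \<open>V' \<le> - c1 * V powr \<alpha> - c2 * V powr \<beta>\<close>. The
  superlinear term brings any value of \<open>V\<close> below 1 within time \<open>1 / (c2 * (\<beta> - 1))\<close>, and the
  sublinear one then brings it to 0 within \<open>1 / (c1 * (1 - \<alpha>))\<close>. As these bounds do not depend on
  the starting value, one can start at arbitrarily small positive times, so the behaviour of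
  the solution at \<open>t = 0\<close> plays no role.
\<close>

section \<open>Differential inequalities and extinction in fixed time\<close>

text \<open>A mean value inequality that tolerates the countable set of instants at which
  \<open>solves\<close> lets the equation fail.\<close>

lemma derivative_le_off_countable:
  fixes f f' :: "real \<Rightarrow> real"
  assumes "a \<le> b" and cont: "continuous_on {a..b} f" and "countable S"
    and der: "\<And>t. t \<in> {a<..<b} - S \<Longrightarrow> (f has_real_derivative f' t) (at t)"
    and le: "\<And>t. t \<in> {a<..<b} - S \<Longrightarrow> f' t \<le> m"
  shows "f b - f a \<le> m * (b - a)"
proof (rule ccontr)
  assume "\<not> f b - f a \<le> m * (b - a)"
  then have gap: "m * (b - a) < f b - f a" by simp
  with \<open>a \<le> b\<close> have "a < b" by (cases "a = b") auto
  have "m < (f b - f a) / (b - a)" using gap \<open>a < b\<close> by (simp add: pos_less_divide_eq)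
  then obtain n where "m < n" and n: "n < (f b - f a) / (b - a)" using dense by blast
  \<comment> \<open>Tilting by a slope strictly between \<open>m\<close> and the mean slope of
    \<open>f\<close> makes the derivative of \<open>g\<close> strictly negative off
    \<open>S\<close>, although \<open>g a < g b\<close>.\<close>
  define g where "g t = f t - n * t" for t
  have "g a < g b" using n \<open>a < b\<close> by (simp add: g_def pos_less_divide_eq algebra_simps)
  have contg: "continuous_on {a..b} g" unfolding g_def by (intro continuous_intros cont)
  have "uncountable {g a<..<g b}" using \<open>g a < g b\<close> by (simp add: uncountable_open_interval)
  moreover have "countable (g ` S)" using \<open>countable S\<close> by simp
  \<comment> \<open>At the last time \<open>g\<close> takes a value outside \<open>g ` S\<close>, \<open>g\<close> is differentiable, though \<open>g\<close> exceeds that value afterwards.\<close>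
  ultimately obtain c where c: "g a < c" "c < g b" "c \<notin> g ` S"
    by (metis countable_subset greaterThanLessThan_iff subsetI)
  define Z where "Z = {t \<in> {a..b}. g t \<le> c}"
  have "closed Z"
    using continuous_closed_preimage[OF contg closed_atLeastAtMost closed_atMost, of c]
    by (simp add: Z_def vimage_def Int_def)
  moreover have "a \<in> Z" "bdd_above Z" using c \<open>a < b\<close> by (auto simp: Z_def intro!: bdd_aboveI[of _ b])
  ultimately have SZ: "Sup Z \<in> Z" by (intro closed_contains_Sup) auto
  define s where "s = Sup Z"
  have s: "a \<le> s" "s \<le> b" "g s \<le> c" using SZ by (auto simp: Z_def s_def)
  have after: "c < g t" if "s < t" "t \<le> b" for t
    using that cSup_upper[OF _ \<open>bdd_above Z\<close>, of t] s by (force simp: Z_def s_def not_le)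
  have "s < b" using s c by (cases "s = b") auto
  have "g s = c"
  proof (rule ccontr)
    assume "g s \<noteq> c"
    then obtain t where "s \<le> t" "t \<le> b" "g t = c"
      using IVT'[of g s c b] s c continuous_on_subset[OF contg] by force
    then show False using after[of t] \<open>g s \<noteq> c\<close> by (cases "t = s") auto
  qed
  then have "s \<notin> S" "a < s" using c s by (auto intro: order.not_eq_order_implies_strict)
  then have sm: "s \<in> {a<..<b} - S" using \<open>s < b\<close> by auto
  have "(g has_real_derivative f' s - n) (at s)"
    unfolding g_def by (auto intro!: derivative_eq_intros der[OF sm])
  moreover have "f' s - n < 0" using le[OF sm] \<open>m < n\<close> by linarith
  ultimately obtain d where d: "d > 0" "\<And>h. 0 < h \<Longrightarrow> h < d \<Longrightarrow> g (s + h) < g s"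
    using DERIV_neg_dec_right by blast
  have "g (s + min (d/2) (b - s)) < g s" using d \<open>s < b\<close> by (intro d) auto
  moreover have "c < g (s + min (d/2) (b - s))" using d \<open>s < b\<close> by (intro after) auto
  ultimately show False using \<open>g s = c\<close> by simp
qed

text \<open>Separation of variables in two phases, keeping one power in each. The hypotheses concern
  positive times only, so the value at the exact time bound is obtained as a limit from the
  right.\<close>

lemma fixed_time_extinction:
  fixes V V' :: "real \<Rightarrow> real"
  assumes cont: "continuous_on {0<..} V" and nonneg: "\<And>t. 0 < t \<Longrightarrow> 0 \<le> V t"
    and "countable S"
    and der: "\<And>t. t \<in> {0<..} - S \<Longrightarrow> (V has_real_derivative V' t) (at t)"
    and decay: "\<And>t. t \<in> {0<..} - S \<Longrightarrow> V' t \<le> - c1 * V t powr \<alpha> - c2 * V t powr \<beta>"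
    and pos: "0 < c1" "0 < c2" "\<alpha> < 1" "1 < \<beta>"
  shows "V (1 / (c1 * (1 - \<alpha>)) + 1 / (c2 * (\<beta> - 1))) = 0"
proof -
  define T1 where "T1 = 1 / (c1 * (1 - \<alpha>))"
  define T2 where "T2 = 1 / (c2 * (\<beta> - 1))"
  have T: "0 < T1" "0 < T2" using pos by (simp_all add: T1_def T2_def)
  have mono: "V t \<le> V s" if "0 < s" "s \<le> t" for s t
  proof -
    have "V' r \<le> 0" if "r \<in> {s<..<t} - S" for r
    proof -
      have "0 \<le> c1 * V r powr \<alpha>" "0 \<le> c2 * V r powr \<beta>" using pos by auto
      then show ?thesis using decay[of r] that \<open>0 < s\<close> by force
    qed
    then have "V t - V s \<le> 0 * (t - s)"
      using that by (intro derivative_le_off_countable[where S = S and f' = V']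
          continuous_on_subset[OF cont] der \<open>countable S\<close>) auto
    then show ?thesis by simp
  qed
  \<comment> \<open>\<open>F'\<close> will be the reciprocal of one summand of the decay rate. The
    other summand is nonnegative, so \<open>F\<close> along \<open>V\<close> falls at least at unit
    speed while \<open>V\<close> is positive.\<close>
  have phase: "F (V t) - F (V s) \<le> - (t - s)"
    if st: "0 < s" "s \<le> t" "0 < V t"
      and F: "\<And>v. 0 < v \<Longrightarrow> (F has_real_derivative F' v) (at v)" "\<And>v. 0 < v \<Longrightarrow> 0 < F' v"
      and le: "\<And>v. 0 < v \<Longrightarrow> 1 \<le> F' v * (c1 * v powr \<alpha> + c2 * v powr \<beta>)"
    for s t and F F' :: "real \<Rightarrow> real"
  proof -
    have Vpos: "0 < V r" if "r \<in> {s..t}" for r using mono[of r t] that st by auto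
    have contF: "continuous_on {0<..} F"
      using F(1) by (intro DERIV_continuous_on[where D = F']) (auto intro: has_field_derivative_at_within)
    have "F (V t) - F (V s) \<le> (- 1) * (t - s)"
    proof (intro derivative_le_off_countable[where S = S and f' = "\<lambda>r. F' (V r) * V' r"])
      show "continuous_on {s..t} (\<lambda>r. F (V r))"
        using Vpos \<open>0 < s\<close> by (intro continuous_on_compose2[OF contF continuous_on_subset[OF cont]]) auto
      fix r assume r: "r \<in> {s<..<t} - S"
      then have r': "r \<in> {0<..} - S" "0 < V r" using st Vpos by auto
      show "((\<lambda>r. F (V r)) has_real_derivative F' (V r) * V' r) (at r)"
        using DERIV_chain2[OF F(1)[OF r'(2)] der[OF r'(1)]] .
      have "F' (V r) * V' r \<le> F' (V r) * (- c1 * V r powr \<alpha> - c2 * V r powr \<beta>)"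
        using decay[OF r'(1)] F(2)[OF r'(2)] by (intro mult_left_mono) auto
      also have "\<dots> = - (F' (V r) * (c1 * V r powr \<alpha> + c2 * V r powr \<beta>))"
        by (simp add: algebra_simps)
      also have "\<dots> \<le> - 1" using le[OF r'(2)] by simp
      finally show "F' (V r) * V' r \<le> - 1" .
    qed (use st \<open>countable S\<close> in auto)
    then show ?thesis by simp
  qed
  have deriv: "((\<lambda>v. v powr r / (c * r)) has_real_derivative v powr (r - 1) / c) (at v)"
    if "0 < v" "r \<noteq> 0" for c r v :: real
    using that by (cases "c = 0") (auto intro!: derivative_eq_intros)
  have zero: "V t = 0" if "T1 + T2 < t" for t
  proof (rule ccontr)
    assume "V t \<noteq> 0"
    then have "0 < V t" using nonneg[of t] T that by auto
    \<comment> \<open>The phases have lengths \<open>T2\<close> and \<open>T1\<close> and end at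
      \<open>t\<close>. They start at a positive time because \<open>t\<close> exceeds
      \<open>T1 + T2\<close> strictly.\<close>
    define s where "s = t - T1 - T2"
    have s: "0 < s" "s + T2 \<le> t" using that T by (auto simp: s_def)
    have pos': "0 < V (s + T2)" "0 < V s"
      using mono[of "s + T2" t] mono[of s t] s T \<open>0 < V t\<close> by auto
    have "V (s + T2) powr (1 - \<beta>) / (c2 * (1 - \<beta>)) - V s powr (1 - \<beta>) / (c2 * (1 - \<beta>)) \<le> - (s + T2 - s)"
    proof (rule phase[where F' = "\<lambda>v. v powr (1 - \<beta> - 1) / c2"])
      show "((\<lambda>v. v powr (1 - \<beta>) / (c2 * (1 - \<beta>))) has_real_derivative v powr (1 - \<beta> - 1) / c2) (at v)"
        if "0 < v" for v using that pos by (intro deriv) auto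
      show "1 \<le> v powr (1 - \<beta> - 1) / c2 * (c1 * v powr \<alpha> + c2 * v powr \<beta>)" if "0 < v" for v
        using that pos by (simp add: field_simps powr_minus)
    qed (use s T pos pos' in auto)
    \<comment> \<open>This sign makes the first phase independent of the starting value: at its end
      the antiderivative lies below \<open>- T2\<close>, whatever \<open>V s\<close> was.\<close>
    moreover have "V s powr (1 - \<beta>) / (c2 * (1 - \<beta>)) < 0"
      using pos pos' by (auto simp: divide_less_0_iff mult_less_0_iff)
    moreover have "V (s + T2) powr (1 - \<beta>) / (c2 * (1 - \<beta>)) = - (V (s + T2) powr (1 - \<beta>) / (c2 * (\<beta> - 1)))"
      by (metis minus_diff_eq minus_divide_right mult_minus_right)
    ultimately have "T2 < V (s + T2) powr (1 - \<beta>) / (c2 * (\<beta> - 1))" by simp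
    then have "1 < V (s + T2) powr (1 - \<beta>)"
      using pos by (simp add: T2_def divide_less_cancel)
    then have "V (s + T2) < 1"
      using powr_mono2'[of "1 - \<beta>" 1 "V (s + T2)"] pos by (force simp: not_le[symmetric])
    then have "V (s + T2) powr (1 - \<alpha>) < 1"
      using pos pos' powr_less_mono2[of "1 - \<alpha>" "V (s + T2)" 1] by auto
    then have "V (s + T2) powr (1 - \<alpha>) / (c1 * (1 - \<alpha>)) < T1"
      unfolding T1_def using pos by (intro divide_strict_right_mono) auto
    moreover have "V t powr (1 - \<alpha>) / (c1 * (1 - \<alpha>)) - V (s + T2) powr (1 - \<alpha>) / (c1 * (1 - \<alpha>)) \<le> - (t - (s + T2))"
    proof (rule phase[where F' = "\<lambda>v. v powr (1 - \<alpha> - 1) / c1"])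
      show "((\<lambda>v. v powr (1 - \<alpha>) / (c1 * (1 - \<alpha>))) has_real_derivative v powr (1 - \<alpha> - 1) / c1) (at v)"
        if "0 < v" for v using that pos by (intro deriv) auto
      show "1 \<le> v powr (1 - \<alpha> - 1) / c1 * (c1 * v powr \<alpha> + c2 * v powr \<beta>)" if "0 < v" for v
        using that pos by (simp add: field_simps powr_minus)
    qed (use s T pos \<open>0 < V t\<close> in auto)
    moreover have "0 < V t powr (1 - \<alpha>) / (c1 * (1 - \<alpha>))" using pos \<open>0 < V t\<close> by auto
    ultimately show False by (simp add: s_def)
  qed
  have "(V \<longlongrightarrow> V (T1 + T2)) (at_right (T1 + T2))"
    using cont T by (metis add_pos_pos at_within_open continuous_on_def filterlim_at_split greaterThan_iff open_greaterThan)
  moreover have "(V \<longlongrightarrow> 0) (at_right (T1 + T2))"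
    by (rule tendsto_eventually) (auto simp: eventually_at_filter zero)
  ultimately show ?thesis
    using tendsto_unique trivial_limit_at_right_real unfolding T1_def T2_def by blast
qed

section \<open>Sums of powers against powers of sums\<close>

text \<open>After division by their sum the terms lie in [0, 1], where a power with
  \<open>p \<le> 1\<close> only enlarges, and they add up to 1.\<close>

lemma powr_sum_le_sum_powr:
  fixes z :: "'a \<Rightarrow> real"
  assumes "finite K" "\<And>i. i \<in> K \<Longrightarrow> 0 \<le> z i" "0 < p" "p \<le> 1"
  shows "sum z K powr p \<le> (\<Sum>i\<in>K. z i powr p)"
proof (cases "sum z K = 0")
  case True
  then show ?thesis by (auto intro!: sum_nonneg)
next
  case False
  define s where "s = sum z K"
  have "0 < s" using False assms sum_nonneg[of K z] by (force simp: s_def)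
  have "z i / s \<le> (z i / s) powr p" if "i \<in> K" for i
  proof (cases "z i = 0")
    case False
    have "z i \<le> s" unfolding s_def using assms that by (intro member_le_sum) auto
    then have "(z i / s) powr 1 \<le> (z i / s) powr p"
      using assms that False \<open>0 < s\<close> by (intro powr_mono') auto
    then show ?thesis using assms that \<open>0 < s\<close> by (simp add: powr_one)
  qed simp
  then have "(\<Sum>i\<in>K. z i / s) \<le> (\<Sum>i\<in>K. (z i / s) powr p)" by (rule sum_mono)
  also have "\<dots> = (\<Sum>i\<in>K. z i powr p) / s powr p"
    using assms \<open>0 < s\<close> by (simp add: powr_divide sum_divide_distrib)
  finally show ?thesis
    using \<open>0 < s\<close> by (simp add: sum_divide_distrib[symmetric] s_def[symmetric] field_simps)
qed

text \<open>Jensen's inequality for a convex power with equal weights.\<close>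

lemma powr_sum_le_card_sum_powr:
  fixes z :: "'a \<Rightarrow> real"
  assumes "finite K" "\<And>i. i \<in> K \<Longrightarrow> 0 \<le> z i" "1 \<le> p"
  shows "real (card K) powr (1 - p) * sum z K powr p \<le> (\<Sum>i\<in>K. z i powr p)"
proof -
  \<comment> \<open>Dropping the zero terms changes neither sum and leaves positive arguments for
    the convexity. The factor obtained for \<open>J\<close> is at least the one for
    \<open>K\<close>, since the exponent \<open>1 - p\<close> is nonpositive.\<close>
  define J where "J = {i \<in> K. z i \<noteq> 0}"
  have J: "finite J" "J \<subseteq> K" "\<And>i. i \<in> J \<Longrightarrow> 0 < z i"
    using assms by (auto simp: J_def order.not_eq_order_implies_strict)
  have zJ: "sum z K = sum z J" "(\<Sum>i\<in>K. z i powr p) = (\<Sum>i\<in>J. z i powr p)"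
    using assms by (auto simp: J_def intro!: sum.mono_neutral_right)
  show ?thesis
  proof (cases "J = {}")
    case True
    then show ?thesis by (simp add: zJ)
  next
    case False
    define n where "n = real (card J)"
    have n: "0 < n" "n \<le> real (card K)"
      using J False assms by (auto simp: n_def card_gt_0_iff intro!: card_mono)
    have "(\<Sum>i\<in>J. (1 / n) *\<^sub>R z i) powr p \<le> (\<Sum>i\<in>J. (1 / n) * z i powr p)"
      using J False n by (intro convex_on_sum[OF _ _ powr_convex[OF \<open>1 \<le> p\<close>]]) (auto simp: n_def)
    then have "(sum z J / n) powr p \<le> (\<Sum>i\<in>J. z i powr p) / n"
      by (simp add: sum_divide_distrib)
    then have "n * (sum z J / n) powr p \<le> (\<Sum>i\<in>J. z i powr p)"
      using n by (simp add: field_simps)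
    also have "n * (sum z J / n) powr p = n powr (1 - p) * sum z J powr p"
      using n J by (simp add: powr_divide powr_diff sum_nonneg less_imp_le)
    finally have "n powr (1 - p) * sum z J powr p \<le> (\<Sum>i\<in>J. z i powr p)" .
    moreover have "real (card K) powr (1 - p) \<le> n powr (1 - p)"
      using n assms by (intro powr_mono2') auto
    ultimately show ?thesis
      using mult_right_mono[of _ _ "sum z J powr p"] by (fastforce simp: zJ)
  qed
qed

section \<open>Graph Laplacians and their second eigenvalue\<close>

text \<open>Interchange \<open>i\<close> and \<open>j\<close> and average: a discrete integration by
  parts. It serves both the Laplacian form and the pairing of the controller with the
  deviations.\<close>

lemma sum_symmetric_weights_eq:
  fixes w :: "'n::finite \<Rightarrow> 'n \<Rightarrow> real"
  assumes "\<And>i j. w i j = w j i"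
  shows "(\<Sum>i\<in>UNIV. x i * (\<Sum>j\<in>UNIV. w i j * (x i - x j))) =
    (\<Sum>i\<in>UNIV. \<Sum>j\<in>UNIV. w i j * (x i - x j)\<^sup>2) / 2"
proof -
  have "(\<Sum>i\<in>UNIV. \<Sum>j\<in>UNIV. w i j * (x i - x j) * x i) =
      (\<Sum>i\<in>UNIV. \<Sum>j\<in>UNIV. w j i * (x j - x i) * x j)"
    by (rule sum.swap)
  also have "\<dots> = - (\<Sum>i\<in>UNIV. \<Sum>j\<in>UNIV. w i j * (x i - x j) * x j)"
    using assms by (simp add: sum_negf[symmetric] algebra_simps)
  finally have "(\<Sum>i\<in>UNIV. \<Sum>j\<in>UNIV. w i j * (x i - x j)\<^sup>2) =
      2 * (\<Sum>i\<in>UNIV. \<Sum>j\<in>UNIV. w i j * (x i - x j) * x i)"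
    by (simp add: power2_eq_square right_diff_distrib sum_subtractf mult.assoc[symmetric])
  then show ?thesis by (simp add: sum_distrib_left mult_ac)
qed

text \<open>Rows of \<open>laplacian M\<close> sum to zero, so they act on \<open>x\<close> through
  the differences \<open>x $ i - x $ j\<close>, and the diagonal of \<open>M\<close> drops
  out.\<close>

lemma inner_laplacian:
  fixes M :: "real^'n^'n"
  assumes "undirected_graph M"
  shows "x \<bullet> (laplacian M *v x) = (\<Sum>i\<in>UNIV. \<Sum>j\<in>UNIV. M $ i $ j * (x $ i - x $ j)\<^sup>2) / 2"
proof -
  have "(laplacian M *v x) $ i = (\<Sum>j\<in>UNIV. M $ i $ j * (x $ i - x $ j))" for i
  proof -
    have "(laplacian M *v x) $ i =
        (\<Sum>j\<in>UNIV. (if i = j then \<Sum>l\<in>UNIV - {i}. M $ i $ l else - M $ i $ j) * x $ j)"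
      by (simp add: laplacian_def matrix_vector_mult_def)
    also have "\<dots> = (\<Sum>l\<in>UNIV - {i}. M $ i $ l) * x $ i + (\<Sum>j\<in>UNIV - {i}. - M $ i $ j * x $ j)"
      by (subst sum.remove[of _ i]) (auto intro!: sum.cong)
    also have "\<dots> = (\<Sum>j\<in>UNIV - {i}. M $ i $ j * (x $ i - x $ j))"
      by (simp add: sum_distrib_right right_diff_distrib sum_subtractf sum_negf)
    also have "\<dots> = (\<Sum>j\<in>UNIV. M $ i $ j * (x $ i - x $ j))"
      by (subst (2) sum.remove[of _ i]) auto
    finally show ?thesis .
  qed
  then show ?thesis
    using sum_symmetric_weights_eq[of "\<lambda>i j. M $ i $ j" "\<lambda>i. x $ i"] assms
    by (simp add: inner_vec_def undirected_graph_def)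
qed

text \<open>The Rayleigh quotient is invariant under scaling, so it suffices to minimise over the
  compact unit sphere of the hyperplane. Only an attained minimum gives \<open>LEAST\<close> its
  meaning.\<close>

lemma lambda2_attained:
  fixes Q :: "real^'n^'n"
  assumes "1 < CARD('n)"
  obtains x where "x \<noteq> 0" "x \<bullet> vec 1 = 0" "lambda2 Q = (x \<bullet> (Q *v x)) / (x \<bullet> x)"
    "\<And>z. z \<bullet> vec 1 = 0 \<Longrightarrow> lambda2 Q * (z \<bullet> z) \<le> z \<bullet> (Q *v z)"
proof -
  define K where "K = sphere (0 :: real^'n) 1 \<inter> {x. vec 1 \<bullet> x = 0}"
  have norm1: "(1 / norm z) *\<^sub>R z \<in> K" if "z \<noteq> 0" "z \<bullet> vec 1 = 0" for z
    using that by (simp add: K_def inner_commute)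
  have "compact K" unfolding K_def by (intro compact_Int_closed closed_hyperplane) auto
  \<comment> \<open>The difference of two basis vectors is mean-free; this needs two distinct
    vertices.\<close>
  moreover have "K \<noteq> {}"
  proof -
    obtain i j :: 'n where "i \<noteq> j"
      using assms card_le_Suc0_iff_eq[of "UNIV :: 'n set"] by auto
    then have "axis i 1 - axis j (1::real) \<noteq> 0" "(axis i 1 - axis j (1::real)) \<bullet> vec 1 = 0"
      by (simp_all add: axis_eq_axis inner_diff_left inner_axis')
    then show ?thesis using norm1 by blast
  qed
  moreover have "continuous_on K (\<lambda>x. x \<bullet> (Q *v x))"
    by (intro continuous_intros matrix_vector_mult_linear_continuous_on)
  ultimately obtain x where x: "x \<in> K" "\<And>z. z \<in> K \<Longrightarrow> x \<bullet> (Q *v x) \<le> z \<bullet> (Q *v z)"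
    using continuous_attains_inf[of K] by blast
  have xx: "x \<bullet> x = 1" "x \<noteq> 0" "x \<bullet> vec 1 = 0"
    using x by (auto simp: K_def inner_commute dot_square_norm)
  have min: "x \<bullet> (Q *v x) \<le> (z \<bullet> (Q *v z)) / (z \<bullet> z)" if "z \<noteq> 0" "z \<bullet> vec 1 = 0" for z
    using x(2)[OF norm1[OF that]]
    by (simp add: matrix_vector_mult_scaleR dot_square_norm power2_eq_square)
  have l2: "lambda2 Q = x \<bullet> (Q *v x)"
    unfolding lambda2_def
  proof (rule Least_equality)
    show "\<exists>z. z \<noteq> 0 \<and> z \<bullet> vec 1 = 0 \<and> x \<bullet> (Q *v x) = (z \<bullet> (Q *v z)) / (z \<bullet> z)"
      using xx by (intro exI[of _ x]) simp
  qed (use min in auto)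
  show ?thesis
  proof
    show "lambda2 Q * (z \<bullet> z) \<le> z \<bullet> (Q *v z)" if "z \<bullet> vec 1 = 0" for z
      using min[OF _ that] by (cases "z = 0") (auto simp: l2 field_simps)
  qed (use xx l2 in auto)
qed

text \<open>At a minimiser, zero energy would force equal values along edges, hence everywhere by
  connectivity, and a constant vector orthogonal to \<open>vec 1\<close> is zero.\<close>

lemma lambda2_laplacian_pos:
  fixes M :: "real^'n^'n"
  assumes "adjacency_matrix M" "undirected_graph M" "connected_graph M" "1 < CARD('n)"
  shows "0 < lambda2 (laplacian M)"
proof -
  obtain x where x: "x \<noteq> 0" "x \<bullet> vec 1 = 0"
    "lambda2 (laplacian M) = (x \<bullet> (laplacian M *v x)) / (x \<bullet> x)"
    using lambda2_attained[OF \<open>1 < CARD('n)\<close>] by metis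
  have nonneg: "0 \<le> M $ i $ j * (x $ i - x $ j)\<^sup>2" for i j
    using assms(1) by (simp add: adjacency_matrix_def)
  have "x \<bullet> (laplacian M *v x) \<noteq> 0"
  proof
    assume "x \<bullet> (laplacian M *v x) = 0"
    then have zero: "M $ i $ j * (x $ i - x $ j)\<^sup>2 = 0" for i j
      using nonneg by (simp add: inner_laplacian[OF assms(2)] sum_nonneg_eq_0_iff sum_nonneg)
    have edge: "x $ i = x $ j" if "0 < M $ i $ j" for i j
      using zero[of i j] that by simp
    have "x $ i = x $ j" if "(\<lambda>p q. 0 < M $ p $ q)\<^sup>+\<^sup>+ i j" for i j
      using that by induction (auto dest: edge)
    then have const: "x $ i = x $ j" for i j
      using assms(3) by (cases "i = j") (auto simp: connected_graph_def)
    have "x \<bullet> vec 1 = real CARD('n) * x $ i" for i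
    proof -
      have "x \<bullet> vec 1 = (\<Sum>j\<in>(UNIV :: 'n set). x $ j)" by (simp add: inner_vec_def)
      also have "\<dots> = (\<Sum>j\<in>(UNIV :: 'n set). x $ i)" by (intro sum.cong refl const)
      finally show ?thesis by simp
    qed
    then show False using x(1,2) by (simp add: vec_eq_iff)
  qed
  moreover have "0 \<le> x \<bullet> (laplacian M *v x)"
    using nonneg by (simp add: inner_laplacian[OF assms(2)] sum_nonneg)
  ultimately show ?thesis using x by simp
qed

text \<open>Positive entries stay positive and \<open>0 powr r = 0\<close>, so the edges are the
  same.\<close>

lemma entrywise_powr_graph:
  assumes "adjacency_matrix A"
  shows "adjacency_matrix (entrywise_powr A r)"
    and "undirected_graph A \<Longrightarrow> undirected_graph (entrywise_powr A r)"
    and "connected_graph A \<Longrightarrow> connected_graph (entrywise_powr A r)"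
proof -
  have "(0 < A $ i $ j) = (0 < entrywise_powr A r $ i $ j)" for i j
    using assms by (auto simp: entrywise_powr_def adjacency_matrix_def order.order_iff_strict)
  then show "connected_graph A \<Longrightarrow> connected_graph (entrywise_powr A r)"
    by (simp add: connected_graph_def)
qed (simp_all add: adjacency_matrix_def undirected_graph_def entrywise_powr_def)

lemma lambda2_entrywise_powr_pos:
  fixes A :: "real^'n^'n"
  assumes "adjacency_matrix A" "undirected_graph A" "connected_graph A" "1 < CARD('n)"
  shows "0 < lambda2 (laplacian (entrywise_powr A r))"
  using assms by (intro lambda2_laplacian_pos entrywise_powr_graph)

section \<open>Deviations from the mean\<close>

text \<open>The orthogonal projection onto the mean-free vectors, the space over which
  \<open>lambda2\<close> minimises.\<close>

definition deviation :: "('n::finite \<Rightarrow> real) \<Rightarrow> 'n \<Rightarrow> real" where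
  "deviation v i = v i - (\<Sum>j\<in>UNIV. v j) / real CARD('n)"

lemma sum_deviation [simp]: "(\<Sum>i\<in>UNIV. deviation v i) = 0"
  by (simp add: deviation_def sum_subtractf)

lemma deviation_diff: "deviation v i - deviation v j = v i - v j"
  by (simp add: deviation_def)

text \<open>The mean of \<open>w\<close> is multiplied by a sum that is zero. This is used with the
  time derivatives and with the second space derivatives as \<open>w\<close>.\<close>

lemma sum_deviation_mult: "(\<Sum>i\<in>UNIV. deviation v i * deviation w i) = (\<Sum>i\<in>UNIV. deviation v i * w i)"
proof -
  have "(\<Sum>i\<in>UNIV. deviation v i * deviation w i) =
      (\<Sum>i\<in>UNIV. deviation v i * w i) - (\<Sum>i\<in>UNIV. deviation v i) * ((\<Sum>j\<in>UNIV. w j) / real CARD('a))"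
    unfolding sum_distrib_right sum_subtractf[symmetric]
    by (simp add: deviation_def[of w] algebra_simps)
  then show ?thesis by simp
qed

text \<open>The factor 2 arises because the Laplacian form is half of the sum over ordered
  pairs.\<close>

lemma lambda2_deviation_le:
  fixes M :: "real^'n^'n"
  assumes "undirected_graph M" "1 < CARD('n)"
  shows "2 * lambda2 (laplacian M) * (\<Sum>i\<in>UNIV. (deviation v i)\<^sup>2) \<le>
    (\<Sum>i\<in>UNIV. \<Sum>j\<in>UNIV. M $ i $ j * (v i - v j)\<^sup>2)"
proof -
  define z :: "real^'n" where "z = (\<chi> i. deviation v i)"
  have "z \<bullet> vec 1 = 0" by (simp add: z_def inner_vec_def)
  then have "lambda2 (laplacian M) * (z \<bullet> z) \<le> z \<bullet> (laplacian M *v z)"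
    using lambda2_attained[OF assms(2)] by metis
  then show ?thesis
    unfolding inner_laplacian[OF assms(1)]
    by (simp add: z_def inner_vec_def deviation_diff power2_eq_square)
qed

section \<open>Calculus of the Lyapunov function\<close>

text \<open>States take position before time, whereas rules for parameter integrals expect the
  parameter first.\<close>

lemma continuous_on_swap_args:
  assumes "continuous_on (B \<times> A) (\<lambda>(x, t). f x t)"
  shows "continuous_on (A \<times> B) (\<lambda>(t, x). f x t)"
  using continuous_on_compose2[OF assms continuous_on_swap, of "A \<times> B"]
  by (simp add: case_prod_beta' prod.swap_def image_subset_iff)

text \<open>Integration by parts with vanishing boundary terms gives minus the integral of the
  square of \<open>f'\<close>.\<close>

lemma integral_mult_deriv2_nonpos:
  fixes f f' f'' :: "real \<Rightarrow> real"
  assumes "a \<le> b" "f a = 0" "f b = 0"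
    and f': "\<And>x. x \<in> {a..b} \<Longrightarrow> (f has_real_derivative f' x) (at x within {a..b})"
    and f'': "\<And>x. x \<in> {a..b} \<Longrightarrow> (f' has_real_derivative f'' x) (at x within {a..b})"
    and cont: "continuous_on {a..b} f''"
  shows "integral {a..b} (\<lambda>x. f x * f'' x) \<le> 0"
proof -
  have contf: "continuous_on {a..b} f" "continuous_on {a..b} f'"
    using DERIV_continuous_on[OF f'] DERIV_continuous_on[OF f''] by auto
  have "((\<lambda>x. f' x * f' x + f'' x * f x) has_integral f b * f' b - f a * f' a) {a..b}"
    using \<open>a \<le> b\<close> f' f''
    by (intro fundamental_theorem_of_calculus)
      (auto simp: has_real_derivative_iff_has_vector_derivative[symmetric] intro!: DERIV_mult)
  then have "integral {a..b} (\<lambda>x. f' x * f' x + f'' x * f x) = 0"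
    using assms(2,3) by (simp add: integral_unique)
  moreover have "integral {a..b} (\<lambda>x. f' x * f' x + f'' x * f x) =
      integral {a..b} (\<lambda>x. f' x * f' x) + integral {a..b} (\<lambda>x. f'' x * f x)"
    by (intro integral_add integrable_continuous_interval continuous_intros contf cont)
  moreover have "0 \<le> integral {a..b} (\<lambda>x. f' x * f' x)"
    by (intro integral_nonneg integrable_continuous_interval continuous_intros contf) auto
  ultimately show ?thesis by (simp add: mult.commute)
qed

definition disagreement :: "real \<Rightarrow> ('n::finite \<Rightarrow> real \<Rightarrow> real \<Rightarrow> real) \<Rightarrow> real \<Rightarrow> real" where
  "disagreement L y t = integral {0..L} (\<lambda>x. \<Sum>i\<in>UNIV. (deviation (\<lambda>j. y j x t) i)\<^sup>2)"

lemma continuous_on_disagreement: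
  fixes y :: "'n::finite \<Rightarrow> real \<Rightarrow> real \<Rightarrow> real"
  assumes "\<And>i. continuous_on ({0..L} \<times> U) (\<lambda>(x, t). y i x t)"
  shows "continuous_on U (disagreement L y)"
proof -
  have "continuous_on (U \<times> cbox 0 L) (\<lambda>(t, x). \<Sum>i\<in>UNIV. (deviation (\<lambda>j. y j x t) i)\<^sup>2)"
    using continuous_on_swap_args[OF assms] unfolding deviation_def case_prod_beta' cbox_interval
    by (intro continuous_intros) auto
  from integral_continuous_on_param[OF this] show ?thesis
    by (simp add: disagreement_def[abs_def])
qed

lemma disagreement_nonneg: "0 \<le> disagreement L y t"
  unfolding disagreement_def
  \<comment> \<open>For an integrand that is not integrable, \<open>integral\<close> takes the
    default value 0.\<close>
  by (cases "(\<lambda>x. \<Sum>i\<in>UNIV. (deviation (\<lambda>j. y j x t) i)\<^sup>2) integrable_on {0..L}")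
    (auto intro!: integral_nonneg sum_nonneg simp: not_integrable_integral)

text \<open>A continuous nonnegative integrand with integral 0 vanishes at every point of a
  nondegenerate interval, so agreement is pointwise and not just almost everywhere.\<close>

lemma disagreement_eq_0_D:
  fixes y :: "'n::finite \<Rightarrow> real \<Rightarrow> real \<Rightarrow> real"
  assumes "disagreement L y t = 0" and cont: "\<And>i. continuous_on {0..L} (\<lambda>x. y i x t)"
    and "x \<in> {0..L}" "0 < L"
  shows "y i x t = y j x t"
proof -
  have "(\<Sum>i\<in>UNIV. (deviation (\<lambda>j. y j x t) i)\<^sup>2) = 0"
    using assms(1,3) unfolding disagreement_def deviation_def
    by (subst (asm) integral_eq_0_iff) (auto intro!: continuous_intros cont sum_nonneg \<open>0 < L\<close>)
  then have "deviation (\<lambda>j. y j x t) i = 0" for i by (simp add: sum_nonneg_eq_0_iff)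
  then show ?thesis using deviation_diff[of "\<lambda>j. y j x t" i j] by simp
qed

text \<open>Differentiation under the integral sign first produces the deviations of
  \<open>yt\<close>; their mean then drops out by \<open>sum_deviation_mult\<close>.\<close>

lemma has_derivative_disagreement:
  fixes y yt :: "'n::finite \<Rightarrow> real \<Rightarrow> real \<Rightarrow> real"
  assumes "open U" "t \<in> U"
    and y: "\<And>i. continuous_on ({0..L} \<times> U) (\<lambda>(x, t). y i x t)"
    and yt: "\<And>i. continuous_on ({0..L} \<times> U) (\<lambda>(x, t). yt i x t)"
    and der: "\<And>i x t. x \<in> {0..L} \<Longrightarrow> t \<in> U \<Longrightarrow> ((\<lambda>s. y i x s) has_real_derivative yt i x t) (at t)"
  shows "(disagreement L y has_real_derivative
    2 * integral {0..L} (\<lambda>x. \<Sum>i\<in>UNIV. deviation (\<lambda>j. y j x t) i * yt i x t)) (at t)"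
proof -
  \<comment> \<open>The Leibniz rule asks for a convex set of times, which \<open>U\<close> need not
    be.\<close>
  obtain e where e: "0 < e" "ball t e \<subseteq> U"
    using assms(1,2) by (auto simp: open_contains_ball)
  have sub: "{0..L} \<times> ball t e \<subseteq> {0..L} \<times> U" using e by auto
  note contU = continuous_on_swap_args[OF continuous_on_subset[OF y sub]]
    continuous_on_swap_args[OF continuous_on_subset[OF yt sub]]
  have cont: "continuous_on {0..L} (\<lambda>x. y i x s)" if "s \<in> U" for i s
    using that by (intro continuous_on_compose2[OF y, of _ "\<lambda>x. (x, s)", simplified] continuous_intros) auto
  have "((\<lambda>s. integral (cbox 0 L) (\<lambda>x. \<Sum>i\<in>UNIV. (deviation (\<lambda>j. y j x s) i)\<^sup>2))
      has_real_derivative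
      integral (cbox 0 L) (\<lambda>x. 2 * (\<Sum>i\<in>UNIV. deviation (\<lambda>j. y j x t) i * deviation (\<lambda>j. yt j x t) i)))
      (at t within ball t e)"
  proof (intro leibniz_rule_field_derivative)
    fix s x assume "s \<in> ball t e" "x \<in> cbox 0 L"
    then have "((\<lambda>s. y i x s) has_real_derivative yt i x s) (at s within ball t e)" for i
      using e by (intro has_field_derivative_at_within[OF der]) auto
    then show "((\<lambda>s. \<Sum>i\<in>UNIV. (deviation (\<lambda>j. y j x s) i)\<^sup>2) has_real_derivative
        2 * (\<Sum>i\<in>UNIV. deviation (\<lambda>j. y j x s) i * deviation (\<lambda>j. yt j x s) i)) (at s within ball t e)"
    proof -
      assume der: "\<And>i. ((\<lambda>s. y i x s) has_real_derivative yt i x s) (at s within ball t e)"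
      have "((\<lambda>s. deviation (\<lambda>j. y j x s) i) has_real_derivative deviation (\<lambda>j. yt j x s) i)
          (at s within ball t e)" for i
        unfolding deviation_def by (intro DERIV_diff DERIV_cdivide DERIV_sum der)
      then have "((\<lambda>s. \<Sum>i\<in>UNIV. (deviation (\<lambda>j. y j x s) i)\<^sup>2) has_real_derivative
          (\<Sum>i\<in>UNIV. 2 * deviation (\<lambda>j. y j x s) i * deviation (\<lambda>j. yt j x s) i))
          (at s within ball t e)"
        by (auto intro!: derivative_eq_intros simp: mult_ac)
      then show ?thesis by (simp add: sum_distrib_left mult.assoc)
    qed
  next
    fix s assume "s \<in> ball t e"
    then show "(\<lambda>x. \<Sum>i\<in>UNIV. (deviation (\<lambda>j. y j x s) i)\<^sup>2) integrable_on cbox 0 L"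
      using e cont unfolding deviation_def
      by (intro integrable_continuous continuous_intros) auto
  next
    show "continuous_on (ball t e \<times> cbox 0 L)
        (\<lambda>(s, x). 2 * (\<Sum>i\<in>UNIV. deviation (\<lambda>j. y j x s) i * deviation (\<lambda>j. yt j x s) i))"
      using contU unfolding deviation_def case_prod_beta' cbox_interval
      by (intro continuous_intros) auto
  qed (use e in auto)
  then show ?thesis
    using e by (simp add: disagreement_def[abs_def] sum_deviation_mult at_within_open[of t "ball t e"])
qed

section \<open>Dissipation by the controller\<close>

definition sq_distance :: "real \<Rightarrow> ('n \<Rightarrow> real \<Rightarrow> real \<Rightarrow> real) \<Rightarrow> real \<Rightarrow> 'n \<Rightarrow> 'n \<Rightarrow> real" where
  "sq_distance L y t i j = integral {0..L} (\<lambda>x. (y i x t - y j x t)\<^sup>2)"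

lemma sq_distance_commute: "sq_distance L y t i j = sq_distance L y t j i"
  by (simp add: sq_distance_def power2_commute)

lemma sq_distance_nonneg: "0 \<le> sq_distance L y t i j"
  unfolding sq_distance_def
  by (cases "(\<lambda>x. (y i x t - y j x t)\<^sup>2) integrable_on {0..L}")
    (auto intro!: integral_nonneg simp: not_integrable_integral)

lemma integral_sum_sq_distance:
  fixes y :: "'n::finite \<Rightarrow> real \<Rightarrow> real \<Rightarrow> real"
  assumes cont: "\<And>i. continuous_on {0..L} (\<lambda>x. y i x t)"
  shows "((\<lambda>x. \<Sum>i\<in>UNIV. \<Sum>j\<in>UNIV. w i j * (y i x t - y j x t)\<^sup>2) has_integral
    (\<Sum>i\<in>UNIV. \<Sum>j\<in>UNIV. w i j * sq_distance L y t i j)) {0..L}"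
  unfolding sq_distance_def
  by (intro has_integral_sum has_integral_mult_right integrable_integral
      integrable_continuous_interval continuous_intros cont) auto

text \<open>At a fixed time the coefficients of the controller are symmetric and constant in space,
  so the pairing is a weighted sum of squares. Integration supplies the factor that raises the
  exponent \<open>p - 1\<close> to \<open>p\<close>.\<close>

lemma integral_deviation_feedback:
  fixes y :: "'n::finite \<Rightarrow> real \<Rightarrow> real \<Rightarrow> real"
  assumes cont: "\<And>i. continuous_on {0..L} (\<lambda>x. y i x t)" and "undirected_graph A"
  shows "((\<lambda>x. \<Sum>i\<in>UNIV. deviation (\<lambda>j. y j x t) i * feedback L p A y i x t) has_integral
    (\<Sum>i\<in>UNIV. \<Sum>j\<in>UNIV. A $ i $ j * sq_distance L y t i j powr p) / 2) {0..L}"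
proof -
  define w where "w i j = A $ i $ j * sq_distance L y t i j powr (p - 1)" for i j
  have "w i j = w j i" for i j
    using assms(2) by (simp add: w_def undirected_graph_def sq_distance_commute[of L y t i j])
  then have "(\<Sum>i\<in>UNIV. deviation (\<lambda>j. y j x t) i * feedback L p A y i x t) =
      (\<Sum>i\<in>UNIV. \<Sum>j\<in>UNIV. w i j * (y i x t - y j x t)\<^sup>2) / 2" for x
    using sum_symmetric_weights_eq[of w "deviation (\<lambda>j. y j x t)"]
    by (simp add: deviation_diff feedback_def w_def sq_distance_def)
  \<comment> \<open>At distance 0 both sides vanish, since \<open>0 powr p = 0\<close>.\<close>
  moreover have "w i j * sq_distance L y t i j = A $ i $ j * sq_distance L y t i j powr p" for i j
    using sq_distance_nonneg[of L y t i j]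
    by (cases "sq_distance L y t i j = 0") (simp_all add: w_def powr_diff)
  ultimately show ?thesis
    using has_integral_divide[OF integral_sum_sq_distance[of L y t w, OF cont], of 2] by (simp only:)
qed

lemma lambda2_disagreement_le:
  fixes y :: "'n::finite \<Rightarrow> real \<Rightarrow> real \<Rightarrow> real"
  assumes cont: "\<And>i. continuous_on {0..L} (\<lambda>x. y i x t)"
    and "undirected_graph M" "1 < CARD('n)"
  shows "2 * lambda2 (laplacian M) * disagreement L y t \<le>
    (\<Sum>i\<in>UNIV. \<Sum>j\<in>UNIV. M $ i $ j * sq_distance L y t i j)"
proof -
  have "(\<lambda>x. \<Sum>i\<in>UNIV. (deviation (\<lambda>j. y j x t) i)\<^sup>2) integrable_on {0..L}"
    unfolding deviation_def
    by (intro integrable_continuous_interval continuous_intros cont) auto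
  then have "((\<lambda>x. 2 * lambda2 (laplacian M) * (\<Sum>i\<in>UNIV. (deviation (\<lambda>j. y j x t) i)\<^sup>2)) has_integral
      2 * lambda2 (laplacian M) * disagreement L y t) {0..L}"
    unfolding disagreement_def by (intro has_integral_mult_right integrable_integral)
  then show ?thesis
    by (rule has_integral_le[OF _ integral_sum_sq_distance[of L y t, OF cont]])
      (rule lambda2_deviation_le[OF assms(2,3)])
qed

text \<open>Weighting each squared distance by \<open>a i j powr (1 / p)\<close> absorbs the weight
  into the power: the sum of the \<open>p\<close>-th powers is the dissipation, while the plain sum
  is the energy of the graph with these entries, bounded below through its second eigenvalue. This
  is the origin of the matrices in \<open>C1\<close> and \<open>C2\<close>.\<close>

lemma edge_energies:
  fixes y :: "'n::finite \<Rightarrow> real \<Rightarrow> real \<Rightarrow> real"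
  assumes cont: "\<And>i. continuous_on {0..L} (\<lambda>x. y i x t)"
    and A: "adjacency_matrix A" "undirected_graph A" "connected_graph A"
    and "1 < CARD('n)" "0 < p"
  obtains z :: "'n \<times> 'n \<Rightarrow> real" where "\<And>e. 0 \<le> z e"
    "(2 * lambda2 (laplacian (entrywise_powr A (1 / p)))) powr p * disagreement L y t powr p \<le>
      sum z UNIV powr p"
    "(\<Sum>e\<in>UNIV. z e powr p) =
      (\<Sum>i\<in>UNIV. \<Sum>j\<in>UNIV. A $ i $ j * sq_distance L y t i j powr p)"
proof
  note graph = entrywise_powr_graph[OF A(1), of "1 / p"]
  have l2: "0 < lambda2 (laplacian (entrywise_powr A (1 / p)))"
    by (rule lambda2_entrywise_powr_pos[OF A \<open>1 < CARD('n)\<close>])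
  define z where "z = (\<lambda>(i, j). entrywise_powr A (1 / p) $ i $ j * sq_distance L y t i j)"
  show "0 \<le> z e" for e
    using graph(1) by (auto simp: z_def adjacency_matrix_def sq_distance_nonneg split: prod.split)
  have "(2 * lambda2 (laplacian (entrywise_powr A (1 / p)))) powr p * disagreement L y t powr p =
      (2 * lambda2 (laplacian (entrywise_powr A (1 / p))) * disagreement L y t) powr p"
    using l2 disagreement_nonneg[of L y t] by (simp add: powr_mult)
  also have "\<dots> \<le> sum z UNIV powr p"
    using lambda2_disagreement_le[of L y t, OF cont graph(2)[OF A(2)] \<open>1 < CARD('n)\<close>] l2
      disagreement_nonneg[of L y t] \<open>0 < p\<close>
    by (intro powr_mono2) (auto simp: z_def sum.cartesian_product)
  finally show "(2 * lambda2 (laplacian (entrywise_powr A (1 / p)))) powr p * disagreement L y t powr p \<le>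
      sum z UNIV powr p" .
  show "(\<Sum>e\<in>UNIV. z e powr p) =
      (\<Sum>i\<in>UNIV. \<Sum>j\<in>UNIV. A $ i $ j * sq_distance L y t i j powr p)"
    using A(1) sq_distance_nonneg[of L y t] \<open>0 < p\<close>
    by (simp add: z_def sum.cartesian_product entrywise_powr_def adjacency_matrix_def powr_mult
        powr_powr case_prod_beta')
qed

section \<open>Consensus of the closed loop\<close>

lemma solves_continuous_on:
  assumes "solves L k \<alpha> \<beta> A y0 y"
  shows "continuous_on ({0..L} \<times> {0<..}) (\<lambda>(x, t). y i x t)"
proof (rule continuous_on_subset)
  show "continuous_on ({0..L} \<times> {0..} - {(0, 0), (L, 0)}) (\<lambda>(x, t). y i x t)"
    using assms by (simp add: solves_def)
qed auto

lemma disagreement_vanishes: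
  fixes A :: "real^'n^'n"
  assumes \<alpha>: "0 < \<alpha>" "\<alpha> < 1" and \<beta>: "1 < \<beta>" and "0 < L" "0 < k"
    and A: "adjacency_matrix A" "undirected_graph A" "connected_graph A"
    and card: "1 < CARD('n)"
    and sol: "solves L k \<alpha> \<beta> A y0 y"
    and C1: "C1 = (2 * lambda2 (laplacian (entrywise_powr A (1 / \<alpha>)))) powr \<alpha>"
    and C2: "C2 = (2 * lambda2 (laplacian (entrywise_powr A (1 / \<beta>)))) powr \<beta>"
  shows "disagreement L y (1 / (C1 * (1 - \<alpha>)) +
    1 / ((real CARD('n) powr (1 - \<beta>))\<^sup>2 * C2 * (\<beta> - 1))) = 0"
proof -
  obtain S yt yx yxx where S: "closed S" "countable S"
    and yt: "\<forall>i. continuous_on ({0..L} \<times> ({0<..} - S)) (\<lambda>(x, t). yt i x t)"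
    and yxx: "\<forall>i. continuous_on ({0..L} \<times> ({0<..} - S)) (\<lambda>(x, t). yxx i x t)"
    and pde: "\<forall>i. \<forall>x\<in>{0..L}. \<forall>t\<in>{0<..} - S.
      ((\<lambda>s. y i x s) has_real_derivative yt i x t) (at t) \<and>
      ((\<lambda>z. y i z t) has_real_derivative yx i x t) (at x within {0..L}) \<and>
      ((\<lambda>z. yx i z t) has_real_derivative yxx i x t) (at x within {0..L}) \<and>
      yt i x t = k * yxx i x t + controller L \<alpha> \<beta> A y i x t"
    using sol unfolding solves_def by (elim conjE exE) (rule that, assumption+)
  have y: "continuous_on ({0..L} \<times> {0<..}) (\<lambda>(x, t). y i x t)" for i
    using sol by (intro solves_continuous_on)
  have bc: "y i 0 t = 0" "y i L t = 0" if "0 < t" for i t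
    using sol that by (auto simp: solves_def)
  have slice: "continuous_on {0..L} (\<lambda>x. f x t)"
    if "continuous_on ({0..L} \<times> U) (\<lambda>(x, t). f x t)" "t \<in> U" for t U and f :: "real \<Rightarrow> real \<Rightarrow> real"
    using that by (intro continuous_on_compose2[OF that(1), of _ "\<lambda>x. (x, t)", simplified] continuous_intros) auto
  define E where "E p t = (\<Sum>i\<in>UNIV. \<Sum>j\<in>UNIV. A $ i $ j * sq_distance L y t i j powr p)" for p t
  define V' where "V' t = 2 * integral {0..L} (\<lambda>x. \<Sum>i\<in>UNIV. deviation (\<lambda>j. y j x t) i * yt i x t)" for t
  show ?thesis
  proof (rule fixed_time_extinction)
    show "continuous_on {0<..} (disagreement L y)"
      by (rule continuous_on_disagreement[OF y])
    show "0 \<le> disagreement L y t" for t by (rule disagreement_nonneg)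
    show "(disagreement L y has_real_derivative V' t) (at t)" if "t \<in> {0<..} - S" for t
      unfolding V'_def
      by (rule has_derivative_disagreement[OF _ that continuous_on_subset[OF y] yt[rule_format]])
        (use S pde in \<open>blast intro: open_Diff open_greaterThan | auto\<close>)+
    show "V' t \<le> - C1 * disagreement L y t powr \<alpha> -
        (real CARD('n) powr (1 - \<beta>))\<^sup>2 * C2 * disagreement L y t powr \<beta>"
      if t: "t \<in> {0<..} - S" for t
    proof -
      have cy: "continuous_on {0..L} (\<lambda>x. y i x t)" for i
        using slice[OF y] t by auto
      have cyxx: "continuous_on {0..L} (\<lambda>x. yxx i x t)" for i
        using slice[OF yxx[rule_format]] t by auto
      let ?d = "\<lambda>i x. deviation (\<lambda>j. y j x t) i"
      let ?dxx = "\<lambda>i x. deviation (\<lambda>j. yxx j x t) i"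
      have "((\<lambda>x. \<Sum>i\<in>UNIV. ?d i x * ?dxx i x) has_integral
          (\<Sum>i\<in>UNIV. integral {0..L} (\<lambda>x. ?d i x * ?dxx i x))) {0..L}"
        unfolding deviation_def
        by (intro has_integral_sum integrable_integral integrable_continuous_interval
            continuous_intros cy cyxx) auto
      \<comment> \<open>Exchanging \<open>yxx\<close> for its deviation leaves the sum unchanged and
        pairs each deviation, which vanishes at both ends, with its own second derivative.\<close>
      then have diffusion: "((\<lambda>x. \<Sum>i\<in>UNIV. ?d i x * yxx i x t) has_integral
          (\<Sum>i\<in>UNIV. integral {0..L} (\<lambda>x. ?d i x * ?dxx i x))) {0..L}"
        by (simp only: sum_deviation_mult)
      have "integral {0..L} (\<lambda>x. ?d i x * ?dxx i x) \<le> 0" for i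
      proof (rule integral_mult_deriv2_nonpos)
        show "((\<lambda>x. ?d i x) has_real_derivative deviation (\<lambda>j. yx j x t) i) (at x within {0..L})"
          if "x \<in> {0..L}" for x
          unfolding deviation_def using that t pde by (intro DERIV_diff DERIV_cdivide DERIV_sum) auto
        show "((\<lambda>x. deviation (\<lambda>j. yx j x t) i) has_real_derivative ?dxx i x) (at x within {0..L})"
          if "x \<in> {0..L}" for x
          unfolding deviation_def using that t pde by (intro DERIV_diff DERIV_cdivide DERIV_sum) auto
        show "continuous_on {0..L} (?dxx i)"
          unfolding deviation_def by (intro continuous_intros cyxx) auto
      qed (use bc t \<open>0 < L\<close> in \<open>auto simp: deviation_def\<close>)
      then have neg: "(\<Sum>i\<in>UNIV. integral {0..L} (\<lambda>x. ?d i x * ?dxx i x)) \<le> 0"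
        by (rule sum_nonpos)
      have "((\<lambda>x. k * (\<Sum>i\<in>UNIV. ?d i x * yxx i x t) -
            (\<Sum>i\<in>UNIV. ?d i x * feedback L \<alpha> A y i x t) -
            (\<Sum>i\<in>UNIV. ?d i x * feedback L \<beta> A y i x t)) has_integral
          k * (\<Sum>i\<in>UNIV. integral {0..L} (\<lambda>x. ?d i x * ?dxx i x)) - E \<alpha> t / 2 - E \<beta> t / 2) {0..L}"
        unfolding E_def
        by (intro has_integral_diff has_integral_mult_right diffusion
            integral_deviation_feedback cy A)
      also have "?this \<longleftrightarrow> ((\<lambda>x. \<Sum>i\<in>UNIV. ?d i x * yt i x t) has_integral
          k * (\<Sum>i\<in>UNIV. integral {0..L} (\<lambda>x. ?d i x * ?dxx i x)) - E \<alpha> t / 2 - E \<beta> t / 2) {0..L}"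
        using t by (intro has_integral_cong)
          (simp add: pde controller_def sum_distrib_left sum_subtractf[symmetric] algebra_simps)
      finally have "V' t = 2 * k * (\<Sum>i\<in>UNIV. integral {0..L} (\<lambda>x. ?d i x * ?dxx i x)) - E \<alpha> t - E \<beta> t"
        by (simp add: V'_def integral_unique)
      also have "\<dots> \<le> - E \<alpha> t - E \<beta> t"
        using neg \<open>0 < k\<close> by (simp add: mult_le_0_iff)
      finally have "V' t \<le> - E \<alpha> t - E \<beta> t" .
      moreover have "C1 * disagreement L y t powr \<alpha> \<le> E \<alpha> t"
      proof -
        obtain z :: "'n \<times> 'n \<Rightarrow> real" where z: "\<And>e. 0 \<le> z e"
          "C1 * disagreement L y t powr \<alpha> \<le> sum z UNIV powr \<alpha>" "(\<Sum>e\<in>UNIV. z e powr \<alpha>) = E \<alpha> t"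
          using edge_energies[of L y t, OF cy A card \<alpha>(1)] unfolding C1 E_def by blast
        then show ?thesis
          using powr_sum_le_sum_powr[of UNIV z \<alpha>] \<alpha> by simp
      qed
      moreover have "(real CARD('n) powr (1 - \<beta>))\<^sup>2 * C2 * disagreement L y t powr \<beta> \<le> E \<beta> t"
      proof -
        obtain z :: "'n \<times> 'n \<Rightarrow> real" where z: "\<And>e. 0 \<le> z e"
          "C2 * disagreement L y t powr \<beta> \<le> sum z UNIV powr \<beta>" "(\<Sum>e\<in>UNIV. z e powr \<beta>) = E \<beta> t"
          using edge_energies[of L y t, OF cy A card order.strict_trans[OF zero_less_one \<beta>]] unfolding C2 E_def by blast
        have "(real CARD('n) powr (1 - \<beta>))\<^sup>2 * C2 * disagreement L y t powr \<beta> \<le>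
            (real CARD('n) powr (1 - \<beta>))\<^sup>2 * sum z UNIV powr \<beta>"
          using mult_left_mono[OF z(2), of "(real CARD('n) powr (1 - \<beta>))\<^sup>2"] by (simp add: mult.assoc)
        \<comment> \<open>The square in the constant comes from Jensen's inequality over all
          \<open>N * N\<close> ordered pairs.\<close>
        also have "\<dots> = real CARD('n \<times> 'n) powr (1 - \<beta>) * sum z UNIV powr \<beta>"
          by (simp add: powr_mult power2_eq_square)
        also have "\<dots> \<le> (\<Sum>e\<in>UNIV. z e powr \<beta>)"
          using z(1) \<beta> by (intro powr_sum_le_card_sum_powr) auto
        finally show ?thesis using z(3) by simp
      qed
      ultimately show ?thesis by linarith
    qed
    \<comment> \<open>Connectivity makes both rates strictly positive.\<close>
    show "0 < C1" "0 < (real CARD('n) powr (1 - \<beta>))\<^sup>2 * C2"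
      using lambda2_entrywise_powr_pos[OF A card] unfolding C1 C2
      by (auto simp: less_imp_neq[symmetric])
  qed (use S \<alpha> \<beta> in auto)
qed

text \<open>Continuity in space makes the agreement at \<open>ts\<close> pointwise; continuity in
  time at the interior instant \<open>ts\<close> turns it into the required limit.\<close>

lemma terminal_time_of_disagreement_0:
  assumes sol: "solves L k \<alpha> \<beta> A y0 y" and "0 < L" "0 < ts" "disagreement L y ts = 0"
  shows "terminal_time L y ts"
  unfolding terminal_time_def
proof (intro conjI ballI allI)
  fix x i j assume x: "x \<in> {0..L}"
  have y: "continuous_on ({0..L} \<times> {0<..}) (\<lambda>(x, t). y i x t)" for i
    using sol by (intro solves_continuous_on)
  have "continuous_on {0..L} (\<lambda>x. y i x ts)" for i
    using \<open>0 < ts\<close> by (intro continuous_on_compose2[OF y, of _ "\<lambda>x. (x, ts)", simplified] continuous_intros) auto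
  then have eq: "y i x ts = y j x ts"
    using disagreement_eq_0_D[OF assms(4) _ x \<open>0 < L\<close>] by blast
  have "continuous_on {0<..} (\<lambda>t. y i x t)" for i
    using x by (intro continuous_on_compose2[OF y, of _ "\<lambda>t. (x, t)", simplified] continuous_intros) auto
  then have "continuous_on {0<..} (\<lambda>t. \<bar>y i x t - y j x t\<bar>)"
    by (intro continuous_intros)
  then have "isCont (\<lambda>t. \<bar>y i x t - y j x t\<bar>) ts"
    using \<open>0 < ts\<close> by (simp add: continuous_on_eq_continuous_at)
  then show "((\<lambda>t. \<bar>y i x t - y j x t\<bar>) \<longlongrightarrow> 0) (at ts within {0..})"
    using eq by (auto simp: isCont_def intro: tendsto_within_subset)
qed (use assms in auto)

theorem corollary3p2:
  fixes \<alpha> \<beta> L k :: real and A :: "real^'n^'n"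
  assumes "0 < \<alpha>" "\<alpha> < 1" "1 < \<beta>" "0 < L" "0 < k"
    and "adjacency_matrix A" "undirected_graph A" "connected_graph A"
  shows "fixed_time_consensus L (trajectories L k \<alpha> \<beta> A) \<and>
    (let N = real CARD('n);
         C1 = (2 * lambda2 (laplacian (entrywise_powr A (1 / \<alpha>)))) powr \<alpha>;
         C2 = (2 * lambda2 (laplacian (entrywise_powr A (1 / \<beta>)))) powr \<beta>;
         Tmax = 1 / (C1 * (1 - \<alpha>)) + 1 / ((N powr (1 - \<beta>))\<^sup>2 * C2 * (\<beta> - 1))
     in \<forall>y \<in> trajectories L k \<alpha> \<beta> A. \<exists>ts. terminal_time L y ts \<and> ts \<le> Tmax)"
proof -
  define C1 where "C1 = (2 * lambda2 (laplacian (entrywise_powr A (1 / \<alpha>)))) powr \<alpha>"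
  define C2 where "C2 = (2 * lambda2 (laplacian (entrywise_powr A (1 / \<beta>)))) powr \<beta>"
  define Tmax where "Tmax = 1 / (C1 * (1 - \<alpha>)) + 1 / ((real CARD('n) powr (1 - \<beta>))\<^sup>2 * C2 * (\<beta> - 1))"
  \<comment> \<open>True for any value of \<open>lambda2\<close>, even an unspecified one: powers
    are nonnegative and division by 0 yields 0.\<close>
  have "0 \<le> Tmax" using assms by (simp add: Tmax_def C1_def C2_def)
  have bound: "\<exists>ts\<le>Tmax. terminal_time L y ts" if y: "y \<in> trajectories L k \<alpha> \<beta> A" for y
  proof (cases "1 < CARD('n)")
    \<comment> \<open>For a single vertex \<open>lambda2\<close> is unspecified, but consensus holds
      trivially at time 0.\<close>
    case False
    then have "i = j" for i j :: 'n
      using card_le_Suc0_iff_eq[of "UNIV :: 'n set"] by auto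
    then have zero: "y i x t - y j x t = 0" for i j x t by (metis cancel_comm_monoid_add_class.diff_cancel)
    have "terminal_time L y 0" unfolding terminal_time_def zero by simp
    then show ?thesis using \<open>0 \<le> Tmax\<close> by blast
  next
    case True
    obtain y0 where sol: "solves L k \<alpha> \<beta> A y0 y"
      using y by (auto simp: trajectories_def)
    have "0 < C1"
      using lambda2_entrywise_powr_pos[OF assms(6-8) True] by (simp add: C1_def less_imp_neq[symmetric])
    then have "0 < Tmax" using assms by (auto simp: Tmax_def C2_def intro!: add_pos_nonneg)
    then show ?thesis
      using terminal_time_of_disagreement_0[OF sol \<open>0 < L\<close>]
        disagreement_vanishes[OF assms True sol C1_def C2_def] by (auto simp: Tmax_def)
  qed
  \<comment> \<open>\<open>fixed_time_consensus\<close> asks for a strictly positive bound, while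
    for a single vertex only \<open>0 \<le> Tmax\<close> is known; hence the added 1.\<close>
  have "\<exists>ts\<le>Tmax + 1. terminal_time L y ts" if "y \<in> trajectories L k \<alpha> \<beta> A" for y
  proof -
    obtain ts where "ts \<le> Tmax" "terminal_time L y ts" using bound[OF \<open>y \<in> _\<close>] by blast
    then show ?thesis by (intro exI[of _ ts]) simp
  qed
  moreover have "0 < Tmax + 1" using \<open>0 \<le> Tmax\<close> by simp
  ultimately have "fixed_time_consensus L (trajectories L k \<alpha> \<beta> A)"
    unfolding fixed_time_consensus_def finite_time_consensus_def by blast
  then show ?thesis
    using bound unfolding Let_def Tmax_def C1_def C2_def by blast
qed

end
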